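(* Let $m\ge 3$ be an integer, $n=2^m-3$, and let $C_1\subset V(H^n)$ be an $(n,2^{2^m-m-3},3)$ code. Then there is exactly one twofold $1$-perfect code $B\subset V(H^{n+2})$ (a multiset) that contains the set $C_100=\{\bar x00\mid \bar x\in C_1\}$ and has the following two properties: (a) the multiplicity in $B$ of every word of $C_100$ is $2$; (b) every codeword $\bar x$ of $B$ whose last two symbols are $01$ or $10$ satisfies $\bar x+0\ldots011\in B$.
   Context: $H^n$ is the graph (hypercube) whose vertex set $V(H^n)$ is the set of all binary words of length $n$, two words being adjacent iff they differ in exactly one position. $d(\cdot,\cdot)$ is the Hamming distance; addition of words is coordinatewise modulo $2$; $0\ldots011$ is the word with ones exactly in the last two positions. For $\bar x=x_1\ldots x_n$, $\bar x00$ denotes the word $x_1\ldots x_n00$ of length $n+2$. An $(n,|C|,d)$ code is a subset $C\subset V(H^n)$ such that $d(\bar x,\bar y)\ge d$ for any two different $\bar x,\bar y\in C$. A twofold $1$-perfect code in $V(H^N)$ is a multiset $B$ of words of $V(H^N)$ such that every vertex $\bar x\in V(H^N)$ is at distance $0$ or $1$ from exactly two codewords of $B$ (counted with multiplicity). *)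

theory Defs
  imports "HOL-Library.Multiset" "HOL-Library.Z2"
begin

definition words :: "nat \<Rightarrow> bit list set" where
  "words n = {x. length x = n}"

(* The two functions below are only used on words of equal length. *)
definition hamming_dist :: "bit list \<Rightarrow> bit list \<Rightarrow> nat" where
  "hamming_dist x y = card {i. i < length x \<and> x ! i \<noteq> y ! i}"

definition word_add :: "bit list \<Rightarrow> bit list \<Rightarrow> bit list" where
  "word_add x y = map2 (+) x y"

definition is_code :: "nat \<Rightarrow> nat \<Rightarrow> nat \<Rightarrow> bit list set \<Rightarrow> bool" where
  "is_code n K d C \<longleftrightarrow>
     C \<subseteq> words n \<and> card C = K \<and>
     (\<forall>x\<in>C. \<forall>y\<in>C. x \<noteq> y \<longrightarrow> d \<le> hamming_dist x y)"

(* Filtering a multiset keeps multiplicities, so codewords are counted with multiplicity. *)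
definition twofold_perfect :: "nat \<Rightarrow> bit list multiset \<Rightarrow> bool" where
  "twofold_perfect N B \<longleftrightarrow>
     set_mset B \<subseteq> words N \<and>
     (\<forall>x\<in>words N. size {#y \<in># B. hamming_dist x y \<le> 1#} = 2)"

end

theory Submission
  imports Defs Complex_Main
begin

text \<open>
  Let \<open>c\<close> (\<open>codeword\<close> below) be the indicator function of the code, \<open>A\<close> the operator that
  sums a function over the neighbours of a word, \<open>T\<close> composition with the antipodal map, and \<open>u = 1 - c - A c\<close>. Since the
  minimum distance is 3, every word is within distance 1 of at most one codeword, so \<open>u\<close>
  (\<open>uncovered\<close> below) is the indicator function of the words that the code leaves uncovered.

  The heart of the proof is a linear programming bound that is attained with equality. The operator
  \<open>M = A\<^sup>2 + 2 A - 1 - 2 T\<close> is diagonalised by the Walsh functions, and on the Walsh function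
  of a set of \<open>s\<close> positions its eigenvalue is \<open>(n - 2 s + 1)\<^sup>2 - 2 - 2 (-1)\<^sup>s\<close>. For
  \<open>n\<close> congruent to 1 modulo 4 this is never negative (\<open>lp_eigenvalue_nonneg\<close>). The packing
  property gives \<open>\<langle>c, M c\<rangle> \<le> (n - 1) |C|\<close>, and for \<open>|C| = 2^n / (n + 3)\<close> the trivial Walsh
  function alone contributes this much. Hence all other components of \<open>M c\<close> vanish and \<open>M c\<close> is the
  constant \<open>n - 1\<close> (\<open>lp_op_tight\<close>, \<open>lp_op_code\<close>). Written in terms of \<open>u\<close> this says
  \<open>u + A u + 2 c + 2 T c = 2\<close> (\<open>coloring_identity\<close>), from which \<open>T u = u\<close> follows.

  A multiset of words of length \<open>n + 2\<close> is described by four multiplicity functions, one for each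
  choice of the last two symbols. Take \<open>2 c\<close> for 00, \<open>u\<close> for 01 and 10, and \<open>2 T c\<close> for 11. The sum
  of the multiplicities over a ball of radius 1 is then, for a centre ending in 00,
  \<open>2 c + 2 A c + 2 u\<close>, which is 2 by the definition of \<open>u\<close>; for a centre ending in 11 it is 2
  because moreover \<open>T u = u\<close>; and for a centre ending in 01 or 10 it is the left-hand side of the
  identity above. So this is a twofold 1-perfect code (\<open>admissibleI\<close>).

  Conversely these multiplicities are forced (\<open>admissibleD\<close>). The balls around covered words
  ending in 00 are already exhausted by the doubled codewords, so every other word in them has
  multiplicity 0. Every uncovered word has a covered neighbour, so no word ending in 00 other than the
  doubled ones occurs; the balls around uncovered words together with property (b) then give \<open>u\<close>
  for 01 and 10, and the balls around words ending in 01 determine the part ending in 11.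
\<close>

section \<open>Words of the hypercube\<close>

definition flip :: "nat \<Rightarrow> bit list \<Rightarrow> bit list" where
  "flip i x = x[i := x ! i + 1]"

definition antipode :: "bit list \<Rightarrow> bit list" where
  "antipode x = map ((+) 1) x"

definition nbr_sum :: "nat \<Rightarrow> (bit list \<Rightarrow> real) \<Rightarrow> bit list \<Rightarrow> real" where
  "nbr_sum n f x = (\<Sum>i<n. f (flip i x))"

lemma bit_add_one_neq: "(b::bit) + 1 \<noteq> b"
  by (cases b) simp_all

lemma bit_neq_iff_add_one: "(b::bit) \<noteq> c \<longleftrightarrow> c = b + 1"
  by (cases b; cases c; simp)

lemma bit_add_one_twice: "(b::bit) + 1 + 1 = b" "1 + (1 + b) = b"
  by (cases b; simp)+

lemma finite_words: "finite (words n)"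
proof -
  have "finite (UNIV :: bit set)"
    by (rule finite_subset[of _ "{0, 1}"]) (auto intro: bit.exhaust)
  then show ?thesis
    using finite_lists_length_eq[of "UNIV :: bit set" n] by (simp add: words_def)
qed

lemma flip_in_words [simp]: "flip i x \<in> words n \<longleftrightarrow> x \<in> words n"
  by (simp add: words_def flip_def)

lemma antipode_in_words [simp]: "antipode x \<in> words n \<longleftrightarrow> x \<in> words n"
  by (simp add: words_def antipode_def)

lemma flip_flip [simp]: "flip i (flip i x) = x"
  by (cases "i < length x") (simp_all only: flip_def list_update_overwrite
      nth_list_update_eq bit_add_one_twice list_update_id list_update_beyond not_less)

lemma antipode_antipode [simp]: "antipode (antipode x) = x"
  by (simp only: antipode_def map_map o_def bit_add_one_twice list.map_ident)

lemma nth_flip: "x \<in> words n \<Longrightarrow> j < n \<Longrightarrow> flip i x ! j = (if j = i then x ! j + 1 else x ! j)"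
  by (auto simp: words_def flip_def nth_list_update)

lemma nth_flip_other: "k \<noteq> i \<Longrightarrow> flip i x ! k = x ! k"
  by (simp add: flip_def)

lemma nth_antipode: "x \<in> words n \<Longrightarrow> j < n \<Longrightarrow> antipode x ! j = x ! j + 1"
  by (simp add: words_def antipode_def add.commute)

lemma words_eqI: "x \<in> words n \<Longrightarrow> y \<in> words n \<Longrightarrow> (\<And>i. i < n \<Longrightarrow> x ! i = y ! i) \<Longrightarrow> x = y"
  by (auto simp: words_def intro: nth_equalityI)

lemma flip_antipode:
  assumes "x \<in> words n"
  shows "flip i (antipode x) = antipode (flip i x)"
  by (rule words_eqI[of _ n]) (use assms in \<open>auto simp: nth_flip nth_antipode\<close>)

lemma nbr_sum_antipode:
  "x \<in> words n \<Longrightarrow> nbr_sum n f (antipode x) = nbr_sum n (\<lambda>y. f (antipode y)) x"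
  by (simp add: nbr_sum_def flip_antipode)

lemma sum_words_flip: "(\<Sum>x\<in>words n. f (flip i x)) = (\<Sum>x\<in>words n. f x)"
  by (rule sum.reindex_bij_witness[of _ "flip i" "flip i"]) auto

lemma sum_words_antipode: "(\<Sum>x\<in>words n. f (antipode x)) = (\<Sum>x\<in>words n. f x)"
  by (rule sum.reindex_bij_witness[of _ antipode antipode]) auto

lemma nbr_sum_diff: "nbr_sum n (\<lambda>y. f y - g y) x = nbr_sum n f x - nbr_sum n g x"
  by (simp add: nbr_sum_def sum_subtractf)

lemma nbr_sum_cmult: "nbr_sum n (\<lambda>y. a * f y) x = a * nbr_sum n f x"
  by (simp add: nbr_sum_def sum_distrib_left)

lemma nbr_sum_const: "nbr_sum n (\<lambda>y. a) x = real n * a"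
  by (simp add: nbr_sum_def)

lemma nbr_sum_cong:
  "x \<in> words n \<Longrightarrow> (\<And>y. y \<in> words n \<Longrightarrow> f y = g y) \<Longrightarrow> nbr_sum n f x = nbr_sum n g x"
  by (simp add: nbr_sum_def)

lemma nbr_sum_nonneg:
  "x \<in> words n \<Longrightarrow> (\<And>y. y \<in> words n \<Longrightarrow> 0 \<le> f y) \<Longrightarrow> 0 \<le> nbr_sum n f x"
  by (simp add: nbr_sum_def sum_nonneg)

lemma nbr_sum_eq_0_iff:
  assumes "x \<in> words n" "\<And>y. y \<in> words n \<Longrightarrow> 0 \<le> f y"
  shows "nbr_sum n f x = 0 \<longleftrightarrow> (\<forall>i<n. f (flip i x) = 0)"
  unfolding nbr_sum_def using assms by (subst sum_nonneg_eq_0_iff) auto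

section \<open>Walsh functions\<close>

definition walsh :: "nat set \<Rightarrow> bit list \<Rightarrow> real" where
  "walsh S x = (\<Prod>i\<in>S. if x ! i = 0 then 1 else -1)"

definition walsh_coeff :: "nat \<Rightarrow> (bit list \<Rightarrow> real) \<Rightarrow> nat set \<Rightarrow> real" where
  "walsh_coeff n f S = (\<Sum>x\<in>words n. f x * walsh S x)"

text \<open>
  The sum over all subsets is the expansion of a product of factors \<open>1 \<plusminus> 1\<close>, one for
  each position, with a factor 0 exactly at the positions where the two words differ.
\<close>

lemma walsh_orthogonality:
  assumes "x \<in> words n" "y \<in> words n"
  shows "(\<Sum>S\<in>Pow {..<n}. walsh S x * walsh S y) = (if x = y then 2 ^ n else 0)"
proof -
  define s :: "nat \<Rightarrow> real" where
    "s i = (if x ! i = 0 then 1 else -1) * (if y ! i = 0 then 1 else -1)" for i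
  have s: "s i = (if x ! i = y ! i then 1 else -1)" for i
    by (cases "x ! i"; cases "y ! i") (simp_all add: s_def)
  have "(\<Sum>S\<in>Pow {..<n}. walsh S x * walsh S y) = (\<Sum>S\<in>Pow {..<n}. \<Prod>i\<in>S. s i)"
    by (simp add: walsh_def s_def prod.distrib)
  also have "\<dots> = (\<Prod>i<n. s i + 1)"
    by (simp add: prod_add)
  also have "\<dots> = (if x = y then 2 ^ n else 0)"
  proof (cases "x = y")
    case False
    then obtain i where "i < n" "x ! i \<noteq> y ! i"
      using assms words_eqI by blast
    then show ?thesis using False by (auto simp: s intro!: prod_zero)
  qed (simp add: s)
  finally show ?thesis .
qed

lemma walsh_inversion:
  assumes x: "x \<in> words n"
  shows "(\<Sum>S\<in>Pow {..<n}. walsh_coeff n f S * walsh S x) = 2 ^ n * f x"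
proof -
  have "(\<Sum>S\<in>Pow {..<n}. walsh_coeff n f S * walsh S x)
      = (\<Sum>S\<in>Pow {..<n}. \<Sum>y\<in>words n. f y * (walsh S y * walsh S x))"
    by (simp only: walsh_coeff_def sum_distrib_right mult.assoc)
  also have "\<dots> = (\<Sum>y\<in>words n. f y * (\<Sum>S\<in>Pow {..<n}. walsh S y * walsh S x))"
    by (subst sum.swap) (simp add: sum_distrib_left)
  also have "\<dots> = (\<Sum>y\<in>words n. if y = x then f y * 2 ^ n else 0)"
    using x by (intro sum.cong) (simp_all add: walsh_orthogonality)
  also have "\<dots> = 2 ^ n * f x"
    using x by (simp add: finite_words)
  finally show ?thesis .
qed

lemma walsh_parseval:
  "(\<Sum>S\<in>Pow {..<n}. walsh_coeff n f S * walsh_coeff n g S) = 2 ^ n * (\<Sum>x\<in>words n. f x * g x)"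
proof -
  have "(\<Sum>S\<in>Pow {..<n}. walsh_coeff n f S * walsh_coeff n g S)
      = (\<Sum>S\<in>Pow {..<n}. \<Sum>x\<in>words n. g x * (walsh_coeff n f S * walsh S x))"
    by (simp add: walsh_coeff_def[of n g] sum_distrib_left mult_ac)
  also have "\<dots> = (\<Sum>x\<in>words n. g x * (\<Sum>S\<in>Pow {..<n}. walsh_coeff n f S * walsh S x))"
    by (subst sum.swap) (simp add: sum_distrib_left)
  also have "\<dots> = 2 ^ n * (\<Sum>x\<in>words n. f x * g x)"
    unfolding sum_distrib_left[of "2 ^ n"]
    by (intro sum.cong) (simp_all only: walsh_inversion, simp)
  finally show ?thesis .
qed

lemma walsh_flip:
  assumes "S \<subseteq> {..<n}" "x \<in> words n"
  shows "walsh S (flip i x) = (if i \<in> S then - walsh S x else walsh S x)"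
proof -
  have fin: "finite S" using assms(1) finite_subset by blast
  have eq: "(if flip i x ! j = 0 then 1 else -1 :: real)
      = (if j = i then -1 else 1) * (if x ! j = 0 then 1 else -1)" if "j \<in> S" for j
  proof (cases "j = i")
    case True
    with assms that show ?thesis by (cases "x ! j") (auto simp: nth_flip)
  qed (simp add: nth_flip_other)
  have "walsh S (flip i x) = (\<Prod>j\<in>S. if j = i then -1 else 1) * walsh S x"
    unfolding walsh_def prod.distrib[symmetric] by (rule prod.cong) (simp_all add: eq)
  also have "(\<Prod>j\<in>S. if j = i then -1 else 1 :: real) = (if i \<in> S then -1 else 1)"
    using fin by (simp add: prod.delta)
  finally show ?thesis by simp
qed

lemma walsh_antipode:
  assumes "S \<subseteq> {..<n}" "x \<in> words n"
  shows "walsh S (antipode x) = (-1) ^ card S * walsh S x"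
proof -
  have eq: "(if antipode x ! j = 0 then 1 else -1 :: real)
      = (-1) * (if x ! j = 0 then 1 else -1)" if "j \<in> S" for j
    using assms that by (cases "x ! j") (auto simp: nth_antipode)
  show ?thesis
    unfolding walsh_def prod_constant[symmetric] prod.distrib[symmetric]
    by (rule prod.cong) (simp_all add: eq)
qed

text \<open>
  Flipping position \<open>i\<close> multiplies the Walsh function by -1 if \<open>i \<in> S\<close> and by 1 otherwise; the sum of
  these signs over all positions is the eigenvalue.
\<close>

lemma walsh_coeff_nbr_sum:
  assumes S: "S \<subseteq> {..<n}"
  shows "walsh_coeff n (nbr_sum n f) S = (real n - 2 * real (card S)) * walsh_coeff n f S"
proof -
  have flip: "(\<Sum>x\<in>words n. f (flip i x) * walsh S x)
      = (if i \<in> S then -1 else 1) * walsh_coeff n f S" for i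
  proof -
    have "(\<Sum>x\<in>words n. f (flip i x) * walsh S x)
        = (\<Sum>x\<in>words n. f (flip i x) * ((if i \<in> S then -1 else 1) * walsh S (flip i x)))"
      using S by (intro sum.cong) (auto simp: walsh_flip)
    also have "\<dots> = (\<Sum>x\<in>words n. f x * ((if i \<in> S then -1 else 1) * walsh S x))"
      by (rule sum_words_flip)
    finally show ?thesis by (simp add: walsh_coeff_def sum_negf)
  qed
  have "walsh_coeff n (nbr_sum n f) S = (\<Sum>i<n. \<Sum>x\<in>words n. f (flip i x) * walsh S x)"
    unfolding walsh_coeff_def nbr_sum_def sum_distrib_right by (rule sum.swap)
  also have "\<dots> = (\<Sum>i<n. if i \<in> S then -1 else 1) * walsh_coeff n f S"
    by (simp add: flip sum_distrib_right)
  also have "(\<Sum>i<n. if i \<in> S then -1 else 1 :: real) = (\<Sum>i<n. 1 - 2 * (if i \<in> S then 1 else 0))"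
    by (rule sum.cong) auto
  also have "\<dots> = real n - 2 * real (card ({..<n} \<inter> S))"
    by (simp add: sum_subtractf sum_distrib_left[symmetric] sum.If_cases Int_def)
  also have "{..<n} \<inter> S = S" using S by blast
  finally show ?thesis .
qed

lemma walsh_coeff_antipode:
  assumes S: "S \<subseteq> {..<n}"
  shows "walsh_coeff n (\<lambda>x. f (antipode x)) S = (-1) ^ card S * walsh_coeff n f S"
proof -
  have "walsh_coeff n (\<lambda>x. f (antipode x)) S
      = (\<Sum>x\<in>words n. f (antipode x) * ((-1) ^ card S * walsh S (antipode x)))"
    unfolding walsh_coeff_def using S
    by (intro sum.cong) (simp_all add: walsh_antipode mult.assoc[symmetric] power_mult_distrib[symmetric])
  also have "\<dots> = (\<Sum>x\<in>words n. f x * ((-1) ^ card S * walsh S x))"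
    by (rule sum_words_antipode)
  finally show ?thesis by (simp add: walsh_coeff_def sum_distrib_left mult_ac)
qed

section \<open>The linear programming operator\<close>

text \<open>
  In terms of distances, this operator assigns the weights \<open>n - 1\<close>, 2, 2 and -2 to the distances 0, 1,
  2 and \<open>n\<close>. The weight -2 at distance \<open>n\<close> does no harm in an upper bound for codes, and it is
  what makes the spectrum nonnegative.
\<close>

definition lp_op :: "nat \<Rightarrow> (bit list \<Rightarrow> real) \<Rightarrow> bit list \<Rightarrow> real" where
  "lp_op n f x = nbr_sum n (nbr_sum n f) x + 2 * nbr_sum n f x - f x - 2 * f (antipode x)"

definition lp_eigenvalue :: "nat \<Rightarrow> nat \<Rightarrow> real" where
  "lp_eigenvalue n s = (real n - 2 * real s + 1)\<^sup>2 - 2 - 2 * (-1) ^ s"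

lemma walsh_coeff_lp_op:
  assumes S: "S \<subseteq> {..<n}"
  shows "walsh_coeff n (lp_op n f) S = lp_eigenvalue n (card S) * walsh_coeff n f S"
proof -
  have "walsh_coeff n (lp_op n f) S = walsh_coeff n (nbr_sum n (nbr_sum n f)) S
      + 2 * walsh_coeff n (nbr_sum n f) S - walsh_coeff n f S
      - 2 * walsh_coeff n (\<lambda>x. f (antipode x)) S"
    by (simp add: walsh_coeff_def lp_op_def algebra_simps sum.distrib sum_subtractf sum_distrib_left)
  also have "\<dots> = lp_eigenvalue n (card S) * walsh_coeff n f S"
    using S by (simp add: walsh_coeff_nbr_sum walsh_coeff_antipode lp_eigenvalue_def
        algebra_simps power2_eq_square)
  finally show ?thesis .
qed

text \<open>
  With \<open>h = (n + 1) / 2 - s\<close> the eigenvalue is \<open>4 h\<^sup>2\<close> for odd \<open>s\<close> and \<open>4 h\<^sup>2 - 4\<close> for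
  even \<open>s\<close>. Since \<open>(n + 1) / 2\<close> is odd, \<open>h\<close> is odd and hence nonzero in the second case.
\<close>

lemma lp_eigenvalue_nonneg:
  assumes "n mod 4 = 1"
  shows "0 \<le> lp_eigenvalue n s"
proof -
  define h :: int where "h = 2 * int (n div 4) + 1 - int s"
  have "n = 4 * (n div 4) + 1" using assms by presburger
  then have "real n = 4 * real (n div 4) + 1" by (metis of_nat_1 of_nat_add of_nat_mult of_nat_numeral)
  then have eq: "lp_eigenvalue n s = 4 * (of_int h)\<^sup>2 - 2 - 2 * (-1) ^ s"
    by (simp add: lp_eigenvalue_def h_def power2_eq_square algebra_simps)
  show ?thesis
  proof (cases "even s")
    case True
    then have "h \<noteq> 0" unfolding h_def by presburger
    then have "1 \<le> \<bar>h\<bar>" by linarith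
    then have "1 \<le> h\<^sup>2" by (metis one_le_power power2_abs)
    then have "1 \<le> (of_int h :: real)\<^sup>2" by (metis of_int_1_le_iff of_int_power)
    with True show ?thesis by (simp add: eq)
  qed (simp add: eq)
qed

text \<open>
  By Parseval, the quadratic form is the sum of the squared Walsh coefficients weighted by the
  eigenvalues. The right-hand side of the bound is the term of the empty set alone, so the remaining
  nonnegative terms all vanish, and inversion shows that the operator maps \<open>f\<close> to a constant.
\<close>

lemma lp_op_tight:
  assumes n: "n mod 4 = 1"
    and le: "2 ^ n * (\<Sum>x\<in>words n. lp_op n f x * f x)
      \<le> (real n - 1) * (real n + 3) * (\<Sum>x\<in>words n. f x)\<^sup>2"
    and x: "x \<in> words n"
  shows "2 ^ n * lp_op n f x = (real n - 1) * (real n + 3) * (\<Sum>x\<in>words n. f x)"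
proof -
  let ?e = "\<lambda>S :: nat set. lp_eigenvalue n (card S)" and ?c = "walsh_coeff n f"
  let ?N = "Pow {..<n} - {{}}"
  have c0: "?c {} = (\<Sum>x\<in>words n. f x)"
    by (simp add: walsh_coeff_def walsh_def)
  have e0: "?e {} = (real n - 1) * (real n + 3)"
    by (simp add: lp_eigenvalue_def power2_eq_square algebra_simps)
  have split: "(\<Sum>S\<in>Pow {..<n}. g S) = g {} + (\<Sum>S\<in>?N. g S)" for g :: "nat set \<Rightarrow> real"
    by (rule sum.remove) auto
  have "2 ^ n * (\<Sum>x\<in>words n. lp_op n f x * f x) = (\<Sum>S\<in>Pow {..<n}. ?e S * (?c S)\<^sup>2)"
    unfolding walsh_parseval[symmetric]
    by (intro sum.cong) (simp_all add: walsh_coeff_lp_op power2_eq_square mult.assoc)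
  also have "\<dots> = ?e {} * (?c {})\<^sup>2 + (\<Sum>S\<in>?N. ?e S * (?c S)\<^sup>2)"
    by (rule split)
  finally have "(\<Sum>S\<in>?N. ?e S * (?c S)\<^sup>2) \<le> 0"
    using le unfolding c0 e0 by linarith
  moreover have nn: "0 \<le> ?e S * (?c S)\<^sup>2" for S
    using lp_eigenvalue_nonneg[OF n] by simp
  ultimately have "(\<Sum>S\<in>?N. ?e S * (?c S)\<^sup>2) = 0"
    by (meson antisym sum_nonneg)
  then have zero: "?e S * (?c S)\<^sup>2 = 0" if "S \<in> ?N" for S
    using that nn by (subst (asm) sum_nonneg_eq_0_iff) auto
  have "2 ^ n * lp_op n f x = (\<Sum>S\<in>Pow {..<n}. ?e S * ?c S * walsh S x)"
    unfolding walsh_inversion[OF x, symmetric]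
    by (intro sum.cong) (simp_all add: walsh_coeff_lp_op)
  also have "\<dots> = ?e {} * ?c {} * walsh {} x + (\<Sum>S\<in>?N. ?e S * ?c S * walsh S x)"
    by (rule split)
  also have "(\<Sum>S\<in>?N. ?e S * ?c S * walsh S x) = 0"
  proof (rule sum.neutral, intro ballI)
    fix S assume "S \<in> ?N"
    from zero[OF this] have "?e S = 0 \<or> ?c S = 0" by simp
    then show "?e S * ?c S * walsh S x = 0" by auto
  qed
  finally show ?thesis using e0 by (simp add: c0 walsh_def)
qed

section \<open>Codes with the parameters of doubly shortened perfect codes\<close>

lemma hamming_dist_flip_le: "hamming_dist x (flip i x) \<le> 1"
proof -
  have "{k. k < length x \<and> x ! k \<noteq> flip i x ! k} \<subseteq> {i}"
    using nth_flip_other by fastforce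
  from card_mono[OF _ this] show ?thesis by (simp add: hamming_dist_def)
qed

lemma hamming_dist_flip_flip_le: "hamming_dist (flip i x) (flip j x) \<le> 2"
proof -
  have "{k. k < length (flip i x) \<and> flip i x ! k \<noteq> flip j x ! k} \<subseteq> {i, j}"
    using nth_flip_other by fastforce
  from card_mono[OF _ this] have "hamming_dist (flip i x) (flip j x) \<le> card {i, j}"
    by (simp add: hamming_dist_def)
  also have "\<dots> \<le> 2" by (simp add: card_insert_if)
  finally show ?thesis .
qed

lemma flip_neq: "x \<in> words n \<Longrightarrow> i < n \<Longrightarrow> flip i x \<noteq> x"
  by (metis bit_add_one_neq nth_flip)

lemma flip_inj: "x \<in> words n \<Longrightarrow> i < n \<Longrightarrow> flip i x = flip j x \<Longrightarrow> i = j"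
  by (metis bit_add_one_neq nth_flip)

text \<open>
  Any two words in a ball of radius 1 have distance at most 2, so a ball contains at most one codeword.
\<close>

lemma distance_3_packing:
  assumes code: "is_code n K 3 C" and x: "x \<in> words n"
  shows "of_bool (x \<in> C) + nbr_sum n (\<lambda>y. of_bool (y \<in> C)) x \<le> 1"
proof -
  have d: "a = b" if "a \<in> C" "b \<in> C" "hamming_dist a b \<le> 2" for a b
    using code that unfolding is_code_def by force
  let ?I = "{i. i < n \<and> flip i x \<in> C}"
  have sum: "nbr_sum n (\<lambda>y. of_bool (y \<in> C)) x = real (card ?I)"
    by (simp add: nbr_sum_def of_bool_def sum.If_cases Int_def)
  show ?thesis
  proof (cases "x \<in> C")
    case True
    have "flip i x \<notin> C" if "i < n" for i
      using d[OF True, of "flip i x"] hamming_dist_flip_le[of x i] flip_neq[OF x that] by auto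
    then have "?I = {}" by blast
    then have "card ?I = 0" by (metis card.empty)
    with True show ?thesis by (simp add: sum)
  next
    case False
    have "card ?I \<le> Suc 0"
      using d hamming_dist_flip_flip_le flip_inj[OF x] by (subst card_le_Suc0_iff_eq) auto
    with False show ?thesis by (simp add: sum)
  qed
qed

text \<open>
  These are the properties of \<open>n = 2^m - 3\<close> and \<open>K = 2^(n - m)\<close> that the argument depends on. For
  \<open>n\<close> congruent to 1 modulo 4, \<open>2^n / (n + 3)\<close> is the linear programming bound on the size of codes with
  minimum distance 3, so \<open>card_eq\<close> says that the code is optimal.
\<close>

locale doubly_shortened_parameters =
  fixes n K :: nat and C :: "bit list set"
  assumes n_mod: "n mod 4 = 1" and n_ge: "n \<ge> 2"
    and card_eq: "K * (n + 3) = 2 ^ n"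
    and code: "is_code n K 3 C"
begin

definition codeword :: "bit list \<Rightarrow> real" where "codeword x = of_bool (x \<in> C)"

text \<open>
  The indicator function of the words at distance at least 2 from the code (see \<open>uncovered_cases\<close>),
  in a form that is linear in the indicator function of the code.
\<close>

definition uncovered :: "bit list \<Rightarrow> real" where "uncovered x = 1 - codeword x - nbr_sum n codeword x"

lemma codeword_cases: "codeword x = 0 \<or> codeword x = 1"
  by (simp add: codeword_def)

lemma codeword_nonneg: "0 \<le> codeword x"
  by (simp add: codeword_def)

lemma nbr_sum_codeword_nonneg: "0 \<le> nbr_sum n codeword x"
  by (simp add: nbr_sum_def codeword_nonneg sum_nonneg)

lemma uncovered_nonneg: "x \<in> words n \<Longrightarrow> 0 \<le> uncovered x"
  using distance_3_packing[OF code] by (simp add: uncovered_def codeword_def[abs_def] algebra_simps)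

lemma uncovered_le_1: "uncovered x \<le> 1"
  using codeword_nonneg[of x] nbr_sum_codeword_nonneg[of x] by (simp add: uncovered_def)

lemma uncovered_cases:
  assumes "x \<in> words n" shows "uncovered x = 0 \<or> uncovered x = 1"
proof -
  have "uncovered x \<in> \<int>"
    unfolding uncovered_def nbr_sum_def codeword_def by (intro Ints_diff Ints_sum) auto
  then show ?thesis
    using uncovered_nonneg[OF assms] uncovered_le_1[of x] by (auto elim!: Ints_cases)
qed

lemma sum_codeword: "(\<Sum>x\<in>words n. codeword x) = real K"
proof -
  have "C \<subseteq> words n" "card C = K" using code by (auto simp: is_code_def)
  then show ?thesis
    by (simp add: codeword_def of_bool_def sum.If_cases finite_words Int_absorb1)
qed

text \<open>
  At a codeword, \<open>A c\<close> is 0, and \<open>A (A c)\<close> is at most \<open>n\<close> because no neighbour of the codeword has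
  more than one neighbour in the code.
\<close>

lemma lp_op_code_le:
  assumes x: "x \<in> words n"
  shows "lp_op n codeword x * codeword x \<le> (real n - 1) * codeword x"
proof (cases "x \<in> C")
  case True
  then have "codeword x = 1" by (simp add: codeword_def)
  with uncovered_nonneg[OF x] nbr_sum_codeword_nonneg[of x]
  have z: "nbr_sum n codeword x = 0"
    by (simp add: uncovered_def)
  have "nbr_sum n codeword (flip i x) \<le> 1" for i
    using uncovered_nonneg[of "flip i x"] codeword_nonneg[of "flip i x"] x by (simp add: uncovered_def)
  then have "nbr_sum n (nbr_sum n codeword) x \<le> real n"
    unfolding nbr_sum_def[of n "nbr_sum n codeword"]
    using sum_bounded_above[of "{..<n}" "\<lambda>i. nbr_sum n codeword (flip i x)" 1] by simp
  then show ?thesis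
    using \<open>codeword x = 1\<close> z codeword_nonneg[of "antipode x"] by (simp add: lp_op_def)
qed (simp add: codeword_def)

lemma lp_op_code:
  assumes x: "x \<in> words n"
  shows "lp_op n codeword x = real n - 1"
proof -
  have pos: "real K * (real n + 3) = 2 ^ n"
    using arg_cong[OF card_eq, of real] by simp
  have "(\<Sum>x\<in>words n. lp_op n codeword x * codeword x) \<le> (\<Sum>x\<in>words n. (real n - 1) * codeword x)"
    by (intro sum_mono lp_op_code_le)
  also have "\<dots> = (real n - 1) * real K"
    by (simp add: sum_distrib_left[symmetric] sum_codeword)
  finally have "2 ^ n * (\<Sum>x\<in>words n. lp_op n codeword x * codeword x) \<le> 2 ^ n * ((real n - 1) * real K)"
    by (intro mult_left_mono) auto
  also have "\<dots> = (real n - 1) * (real n + 3) * (\<Sum>x\<in>words n. codeword x)\<^sup>2"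
    unfolding sum_codeword pos[symmetric] by (simp add: power2_eq_square)
  finally have "2 ^ n * lp_op n codeword x = (real n - 1) * (real n + 3) * (\<Sum>x\<in>words n. codeword x)"
    by (rule lp_op_tight[OF n_mod _ x])
  also have "\<dots> = 2 ^ n * (real n - 1)"
    unfolding sum_codeword pos[symmetric] by simp
  finally show ?thesis by simp
qed

lemma nbr_sum_uncovered:
  "nbr_sum n uncovered x = real n - nbr_sum n codeword x - nbr_sum n (nbr_sum n codeword) x"
  unfolding uncovered_def[abs_def] by (simp add: nbr_sum_diff nbr_sum_const)

text \<open>
  The tight linear programming bound, rewritten by \<open>A u = n - A c - A (A c)\<close>. This is also the ball
  equation of the twofold code at a word ending in 01. In combinatorial
  terms, uncovered words are not codewords or antipodes of codewords and have exactly one uncovered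
  neighbour, and a covered word has two uncovered neighbours, or none if it or its antipode is a
  codeword.
\<close>

lemma coloring_identity:
  assumes "x \<in> words n"
  shows "uncovered x + nbr_sum n uncovered x + 2 * codeword x + 2 * codeword (antipode x) = 2"
  using lp_op_code[OF assms] by (simp add: nbr_sum_uncovered lp_op_def uncovered_def)

text \<open>
  If \<open>x\<close> is uncovered, then its antipode is not a codeword by the identity at \<open>x\<close>. Nor is the antipode
  of a neighbour \<open>y\<close> of \<open>x\<close>: then the identity at \<open>y\<close> would leave \<open>y\<close> without uncovered neighbours,
  although \<open>x\<close> is one. So the antipode of \<open>x\<close> is uncovered as well.
\<close>

lemma uncovered_antipode_le:
  assumes x: "x \<in> words n"
  shows "uncovered x \<le> uncovered (antipode x)"
proof (cases "uncovered x = 0")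
  case False
  with uncovered_cases x have ux: "uncovered x = 1" by blast
  have un: "0 \<le> nbr_sum n uncovered y" if "y \<in> words n" for y
    using nbr_sum_nonneg[OF that] uncovered_nonneg by blast
  have "codeword (antipode x) = 0"
    using coloring_identity[OF x] ux un[OF x] codeword_nonneg[of x] codeword_cases[of "antipode x"] by linarith
  moreover have "codeword (antipode (flip i x)) = 0" if i: "i < n" for i
  proof (rule ccontr)
    let ?y = "flip i x"
    assume "codeword (antipode ?y) \<noteq> 0"
    then have "codeword (antipode ?y) = 1" using codeword_cases by blast
    moreover have y: "?y \<in> words n" using x by simp
    ultimately have "nbr_sum n uncovered ?y = 0"
      using coloring_identity[OF y] un[OF y] uncovered_nonneg[OF y] codeword_nonneg[of ?y] by linarith
    then have "uncovered (flip i ?y) = 0"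
      using nbr_sum_eq_0_iff[OF y, of uncovered] uncovered_nonneg i by blast
    then show False using ux by simp
  qed
  then have "nbr_sum n (\<lambda>y. codeword (antipode y)) x = 0"
    by (simp add: nbr_sum_def)
  ultimately show ?thesis
    using ux x by (simp add: uncovered_def nbr_sum_antipode)
qed (use x uncovered_nonneg in simp)

lemma uncovered_antipode:
  assumes x: "x \<in> words n"
  shows "uncovered (antipode x) = uncovered x"
  using uncovered_antipode_le[OF x] uncovered_antipode_le[of "antipode x"] x by simp

lemma covered_neighbour:
  assumes x: "x \<in> words n" and ux: "uncovered x = 1"
  obtains i where "i < n" "uncovered (flip i x) = 0"
proof -
  have "\<exists>i<n. uncovered (flip i x) = 0"
  proof (rule ccontr)
    assume "\<not> (\<exists>i<n. uncovered (flip i x) = 0)"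
    then have "\<forall>i<n. uncovered (flip i x) = 1" using uncovered_cases x by (meson flip_in_words)
    then have "nbr_sum n uncovered x = real n" by (simp add: nbr_sum_def)
    then show False
      using coloring_identity[OF x] ux n_ge codeword_nonneg[of x] codeword_nonneg[of "antipode x"] by simp
  qed
  then show ?thesis using that by blast
qed

end

section \<open>Twofold perfect codes\<close>

lemma size_filter_eq_sum_count:
  "finite S \<Longrightarrow> size {#y \<in># M. y \<in> S#} = (\<Sum>y\<in>S. count M y)"
  by (induction M) (auto simp: if_distrib sum.distrib sum.If_cases sum.remove Diff_eq Int_absorb2)

lemma hamming_ball_1:
  assumes x: "x \<in> words N"
  shows "{y \<in> words N. hamming_dist x y \<le> 1} = insert x ((\<lambda>i. flip i x) ` {..<N})"
proof (intro set_eqI iffI)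
  fix y assume "y \<in> {y \<in> words N. hamming_dist x y \<le> 1}"
  then have y: "y \<in> words N" and d: "card {i. i < N \<and> x ! i \<noteq> y ! i} \<le> Suc 0"
    using x by (auto simp: hamming_dist_def words_def)
  show "y \<in> insert x ((\<lambda>i. flip i x) ` {..<N})"
  proof (cases "x = y")
    case False
    then obtain i where i: "i < N" "x ! i \<noteq> y ! i" using x y words_eqI by blast
    have uniq: "j = i" if "j < N" "x ! j \<noteq> y ! j" for j
      using d i that by (subst (asm) card_le_Suc0_iff_eq) auto
    have "y = flip i x"
    proof (rule words_eqI[of _ N])
      fix j assume j: "j < N"
      have "y ! i = x ! i + 1" using i(2) bit_neq_iff_add_one by blast
      then show "y ! j = flip i x ! j"
        unfolding nth_flip[OF x j] using uniq[OF j] by metis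
    next
      show "flip i x \<in> words N" using x by simp
    qed (fact y)
    with i show ?thesis by blast
  qed simp
next
  fix y assume "y \<in> insert x ((\<lambda>i. flip i x) ` {..<N})"
  then show "y \<in> {y \<in> words N. hamming_dist x y \<le> 1}"
    using x hamming_dist_flip_le by (auto simp: hamming_dist_def)
qed

lemma size_ball_1:
  assumes B: "set_mset B \<subseteq> words N" and x: "x \<in> words N"
  shows "real (size {#y \<in># B. hamming_dist x y \<le> 1#})
    = real (count B x) + nbr_sum N (\<lambda>y. real (count B y)) x"
proof -
  let ?S = "insert x ((\<lambda>i. flip i x) ` {..<N})"
  have "{#y \<in># B. hamming_dist x y \<le> 1#} = {#y \<in># B. y \<in> ?S#}"
    using B hamming_ball_1[OF x] by (intro filter_mset_cong) auto
  then have "size {#y \<in># B. hamming_dist x y \<le> 1#} = (\<Sum>y\<in>?S. count B y)"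
    by (metis (no_types) finite_imageI finite_insert finite_lessThan size_filter_eq_sum_count)
  also have "\<dots> = count B x + (\<Sum>y\<in>(\<lambda>i. flip i x) ` {..<N}. count B y)"
    using flip_neq[OF x] by (intro sum.insert) force+
  also have "(\<Sum>y\<in>(\<lambda>i. flip i x) ` {..<N}. count B y) = (\<Sum>i<N. count B (flip i x))"
    using flip_inj[OF x] by (subst sum.reindex) (auto intro!: inj_onI)
  finally show ?thesis by (simp add: nbr_sum_def)
qed

lemma words_add_2: "words (n + 2) = {x @ [a, b] | x a b. x \<in> words n}"
proof (intro set_eqI iffI)
  fix w assume "w \<in> words (n + 2)"
  then have "length (drop n w) = 2" "length (take n w) = n" by (auto simp: words_def)
  moreover from this(1) obtain a b where "drop n w = [a, b]"
    unfolding numeral_2_eq_2 length_Suc_conv length_0_conv by blast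
  then have "w = take n w @ [a, b]" by (metis append_take_drop_id)
  ultimately show "w \<in> {x @ [a, b] | x a b. x \<in> words n}"
    unfolding words_def by blast
qed (auto simp: words_def)

lemma nbr_sum_add_2:
  assumes x: "x \<in> words n"
  shows "nbr_sum (n + 2) f (x @ [a, b])
    = nbr_sum n (\<lambda>y. f (y @ [a, b])) x + f (x @ [a + 1, b]) + f (x @ [a, b + 1])"
proof -
  have "length x = n" using x by (simp add: words_def)
  then show ?thesis
    by (simp add: nbr_sum_def flip_def list_update_append nth_append)
qed

text \<open>
  A ball of radius 1 in the larger hypercube consists of a ball in the layer of its centre and one word
  in each of the two adjacent layers, where a layer is given by the last two symbols.
\<close>

lemma twofold_perfect_iff:
  "twofold_perfect (n + 2) B \<longleftrightarrow> set_mset B \<subseteq> words (n + 2) \<and>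
    (\<forall>x\<in>words n. \<forall>a b. real (count B (x @ [a, b])) + nbr_sum n (\<lambda>y. real (count B (y @ [a, b]))) x
      + real (count B (x @ [a + 1, b])) + real (count B (x @ [a, b + 1])) = 2)"
proof -
  have ball: "size {#y \<in># B. hamming_dist (x @ [a, b]) y \<le> 1#} = 2 \<longleftrightarrow>
      real (count B (x @ [a, b])) + nbr_sum n (\<lambda>y. real (count B (y @ [a, b]))) x
      + real (count B (x @ [a + 1, b])) + real (count B (x @ [a, b + 1])) = 2"
    if "set_mset B \<subseteq> words (n + 2)" "x \<in> words n" for x a b
  proof -
    have "x @ [a, b] \<in> words (n + 2)" using that(2) by (simp add: words_def)
    from size_ball_1[OF that(1) this] show ?thesis
      unfolding nbr_sum_add_2[OF that(2)] by linarith
  qed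
  have all: "(\<forall>w\<in>words (n + 2). P w) \<longleftrightarrow> (\<forall>x\<in>words n. \<forall>a b. P (x @ [a, b]))" for P
    unfolding words_add_2 by blast
  show ?thesis
    unfolding twofold_perfect_def all by (intro conj_cong refl ball_cong all_cong1 ball)
qed

lemma word_add_tail:
  assumes "x \<in> words n"
  shows "word_add (x @ [a, b]) (replicate n 0 @ [1, 1]) = x @ [a + 1, b + 1]"
proof -
  have "of_bool (b = 1) = b" for b :: bit
    by (cases b) simp_all
  then show ?thesis
    using assms by (simp add: word_add_def words_def zip_replicate2 o_def)
qed

lemma tail_symmetry_iff:
  assumes B: "set_mset B \<subseteq> words (n + 2)"
  shows "(\<forall>w. w \<in># B \<and> (drop n w = [0, 1] \<or> drop n w = [1, 0])
      \<longrightarrow> word_add w (replicate n 0 @ [1, 1]) \<in># B)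
    \<longleftrightarrow> (\<forall>x\<in>words n. x @ [0, 1] \<in># B \<longleftrightarrow> x @ [1, 0] \<in># B)" (is "?L \<longleftrightarrow> ?R")
proof
  assume L: ?L
  show ?R
  proof
    fix x :: "bit list" assume x: "x \<in> words n"
    then have "length x = n" by (simp add: words_def)
    then show "x @ [0, 1] \<in># B \<longleftrightarrow> x @ [1, 0] \<in># B"
      using L[rule_format, of "x @ [0, 1]"] L[rule_format, of "x @ [1, 0]"]
      by (auto simp: word_add_tail[OF x])
  qed
next
  assume R: ?R
  show ?L
  proof (intro allI impI)
    fix w assume w: "w \<in># B \<and> (drop n w = [0, 1] \<or> drop n w = [1, 0])"
    then have "w \<in> words (n + 2)" using B by blast
    then obtain x a b where x: "x \<in> words n" and wx: "w = x @ [a, b]"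
      unfolding words_add_2 by blast
    then have "drop n w = [a, b]" by (simp add: words_def)
    then show "word_add w (replicate n 0 @ [1, 1]) \<in># B"
      using w R x by (auto simp: wx word_add_tail[OF x])
  qed
qed

section \<open>Existence and uniqueness of the twofold code\<close>

context doubly_shortened_parameters
begin

definition ext_mult :: "bit list \<Rightarrow> bit \<Rightarrow> bit \<Rightarrow> nat" where
  "ext_mult x a b =
    (if a \<noteq> b then of_bool (uncovered x = 1) else if a = 0 then 2 * of_bool (x \<in> C)
     else 2 * of_bool (antipode x \<in> C))"

text \<open>
  The properties that single out the twofold code, with property (b) in the symmetric form of
  \<open>tail_symmetry_iff\<close>.
\<close>

definition admissible :: "bit list multiset \<Rightarrow> bool" where
  "admissible B \<longleftrightarrow> twofold_perfect (n + 2) B \<and> (\<forall>x\<in>C. count B (x @ [0, 0]) = 2)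
    \<and> (\<forall>x\<in>words n. x @ [0, 1] \<in># B \<longleftrightarrow> x @ [1, 0] \<in># B)"

lemma C_words: "x \<in> C \<Longrightarrow> x \<in> words n"
  using code by (auto simp: is_code_def)

lemma ext_mult_eq:
  assumes "x \<in> words n"
  shows "real (ext_mult x 0 0) = 2 * codeword x" "real (ext_mult x 1 1) = 2 * codeword (antipode x)"
    "real (ext_mult x 0 1) = uncovered x" "real (ext_mult x 1 0) = uncovered x"
  using uncovered_cases[OF assms] by (auto simp: ext_mult_def codeword_def)

lemma admissibleI:
  assumes B: "set_mset B \<subseteq> words (n + 2)"
    and count: "\<And>x a b. x \<in> words n \<Longrightarrow> count B (x @ [a, b]) = ext_mult x a b"
  shows "admissible B"
proof -
  have ball: "real (count B (x @ [a, b])) + nbr_sum n (\<lambda>y. real (count B (y @ [a, b]))) x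
      + real (count B (x @ [a + 1, b])) + real (count B (x @ [a, b + 1])) = 2"
    if x: "x \<in> words n" for x a b
  proof -
    have nbr: "nbr_sum n (\<lambda>y. real (count B (y @ [a, b]))) x
        = nbr_sum n (\<lambda>y. real (ext_mult y a b)) x" for a b
      using x by (intro nbr_sum_cong) (simp_all add: count)
    have 00: "nbr_sum n (\<lambda>y. real (ext_mult y 0 0)) x = 2 * nbr_sum n codeword x"
      unfolding nbr_sum_cmult[symmetric] using x by (intro nbr_sum_cong) (simp_all add: ext_mult_eq)
    have 11: "nbr_sum n (\<lambda>y. real (ext_mult y 1 1)) x = 2 * nbr_sum n codeword (antipode x)"
      unfolding nbr_sum_antipode[OF x] nbr_sum_cmult[symmetric]
      using x by (intro nbr_sum_cong) (simp_all add: ext_mult_eq)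
    have 01: "nbr_sum n (\<lambda>y. real (ext_mult y 0 1)) x = nbr_sum n uncovered x"
      "nbr_sum n (\<lambda>y. real (ext_mult y 1 0)) x = nbr_sum n uncovered x"
      using x by (intro nbr_sum_cong; simp add: ext_mult_eq)+
    have "uncovered x = 1 - codeword (antipode x) - nbr_sum n codeword (antipode x)"
      unfolding uncovered_antipode[OF x, symmetric] by (simp add: uncovered_def)
    then show ?thesis
      using coloring_identity[OF x] uncovered_def[of x]
      by (cases a; cases b) (simp_all add: count x nbr 00 11 01 ext_mult_eq)
  qed
  have "x @ [0, 1] \<in># B \<longleftrightarrow> x @ [1, 0] \<in># B" if "x \<in> words n" for x
    using that by (simp flip: count_greater_zero_iff add: count ext_mult_def)
  then show ?thesis
    using B ball C_words unfolding admissible_def twofold_perfect_iff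
    by (auto simp: count ext_mult_def)
qed

text \<open>
  The ball equation at \<open>x00\<close> says that the excess \<open>e\<close> of the multiplicities of words ending in 00 over
  \<open>2 c\<close> satisfies \<open>e + A e + k 0 1 + k 1 0 = 2 u\<close> with nonnegative terms on the left. So everything
  vanishes around covered words, and every word lies in such a neighbourhood. Thus \<open>e = 0\<close>, and the
  multiplicities of \<open>x01\<close> and \<open>x10\<close> add up to \<open>2 u\<close>; by property (b) they cannot be 0 and 2.
\<close>

lemma admissibleD:
  assumes B: "admissible B" and x: "x \<in> words n"
  shows "count B (x @ [a, b]) = ext_mult x a b"
proof -
  define k where "k a b x = real (count B (x @ [a, b]))" for a b x
  have ball: "k a b x + nbr_sum n (k a b) x + k (a + 1) b x + k a (b + 1) x = 2"
    if "x \<in> words n" for x a b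
    using B that unfolding admissible_def twofold_perfect_iff k_def by blast
  have k_nonneg: "0 \<le> k a b x" for a b x by (simp add: k_def)
  define e where "e x = k 0 0 x - 2 * codeword x" for x
  have e_nonneg: "0 \<le> e x" for x
    using B by (auto simp: e_def k_def codeword_def admissible_def)
  have excess: "e x + nbr_sum n e x + k 0 1 x + k 1 0 x = 2 * uncovered x" if "x \<in> words n" for x
    using ball[OF that, of 0 0]
    by (simp add: e_def[abs_def] nbr_sum_diff nbr_sum_cmult uncovered_def)
  have nbr_e: "0 \<le> nbr_sum n e x" if "x \<in> words n" for x
    using that e_nonneg by (rule nbr_sum_nonneg)
  have covered: "e x = 0 \<and> nbr_sum n e x = 0" if "x \<in> words n" "uncovered x = 0" for x
    using excess[OF that(1)] that(2) e_nonneg[of x] nbr_e[OF that(1)]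
      k_nonneg[of 0 1 x] k_nonneg[of 1 0 x] by linarith
  have e0: "e x = 0" if x: "x \<in> words n" for x
  proof (cases "uncovered x = 0")
    case False
    then obtain i where i: "i < n" "uncovered (flip i x) = 0"
      using covered_neighbour x uncovered_cases by metis
    have y: "flip i x \<in> words n" using x by simp
    have "nbr_sum n e (flip i x) = 0" using covered[OF y i(2)] by blast
    then have "e (flip i (flip i x)) = 0"
      using nbr_sum_eq_0_iff[OF y, of e] e_nonneg i(1) by blast
    then show ?thesis by simp
  qed (use covered x in blast)
  have nbr_e0: "nbr_sum n e x = 0" if "x \<in> words n" for x
    using that e0 by (simp add: nbr_sum_def)
  have k00: "k 0 0 x = 2 * codeword x" if "x \<in> words n" for x
    using e0[OF that] by (simp add: e_def)
  have k01_k10: "k 0 1 x = uncovered x \<and> k 1 0 x = uncovered x" if x: "x \<in> words n" for x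
  proof -
    have sum: "k 0 1 x + k 1 0 x = 2 * uncovered x"
      using excess[OF x] e0[OF x] nbr_e0[OF x] by simp
    have sym: "count B (x @ [0, 1]) = 0 \<longleftrightarrow> count B (x @ [1, 0]) = 0"
      using B x unfolding admissible_def by (simp add: count_eq_zero_iff)
    from uncovered_cases[OF x] show ?thesis
    proof
      assume "uncovered x = 1"
      with sum have "count B (x @ [0, 1]) + count B (x @ [1, 0]) = 2"
        unfolding k_def by linarith
      with sym have "count B (x @ [0, 1]) = 1 \<and> count B (x @ [1, 0]) = 1" by arith
      with \<open>uncovered x = 1\<close> show ?thesis by (simp add: k_def)
    qed (use sum k_nonneg[of 0 1 x] k_nonneg[of 1 0 x] in linarith)
  qed
  \<comment> \<open>In the ball around \<open>x01\<close>, only the multiplicity of \<open>x11\<close> is still unknown.\<close>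
  have "nbr_sum n (k 0 1) x = nbr_sum n uncovered x"
    using x k01_k10 by (intro nbr_sum_cong) auto
  then have k11: "k 1 1 x = 2 * codeword (antipode x)"
    using ball[OF x, of 0 1] coloring_identity[OF x] k00[OF x] k01_k10[OF x] by simp
  have "k a b x = real (ext_mult x a b)"
    using k00[OF x] k01_k10[OF x] k11 by (cases a; cases b) (simp_all add: ext_mult_eq[OF x])
  then show ?thesis by (simp add: k_def)
qed

lemma ex1_admissible: "\<exists>!B. admissible B"
proof (rule ex_ex1I)
  define B where "B = (\<Sum>w\<in>words (n + 2).
    replicate_mset (ext_mult (take n w) (w ! n) (w ! (n + 1))) w)"
  have count: "count B w = (if w \<in> words (n + 2)
      then ext_mult (take n w) (w ! n) (w ! (n + 1)) else 0)" for w
    by (simp add: B_def count_sum finite_words)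
  show "\<exists>B. admissible B"
  proof (intro exI admissibleI)
    show "set_mset B \<subseteq> words (n + 2)"
      by (metis count count_eq_zero_iff subsetI)
    show "count B (x @ [a, b]) = ext_mult x a b" if "x \<in> words n" for x a b
      using that by (simp add: count words_def nth_append)
  qed
next
  fix B B' assume BB: "admissible B" "admissible B'"
  show "B = B'"
  proof (rule multiset_eqI)
    fix w
    show "count B w = count B' w"
    proof (cases "w \<in> words (n + 2)")
      case True
      then obtain x a b where "x \<in> words n" "w = x @ [a, b]"
        unfolding words_add_2 by blast
      then show ?thesis using BB by (simp add: admissibleD)
    next
      case False
      then have "w \<notin># B" "w \<notin># B'"
        using BB by (auto simp: admissible_def twofold_perfect_def)
      then show ?thesis by (simp add: count_eq_zero_iff[symmetric])
    qed
  qed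
qed

end

theorem theorem2:
  fixes m n :: nat and C1 :: "bit list set"
  assumes "m \<ge> 3"
    and "n = 2 ^ m - 3"
    and "is_code n (2 ^ (2 ^ m - m - 3)) 3 C1"
  shows "\<exists>!B. twofold_perfect (n + 2) B
            \<and> {x @ [0, 0] | x. x \<in> C1} \<subseteq> set_mset B
            \<and> (\<forall>w \<in> {x @ [0, 0] | x. x \<in> C1}. count B w = 2)
            \<and> (\<forall>x. x \<in># B \<and> (drop n x = [0, 1] \<or> drop n x = [1, 0])
                 \<longrightarrow> word_add x (replicate n 0 @ [1, 1]) \<in># B)"
proof -
  have "(2::nat) ^ m = 8 * 2 ^ (m - 3)"
    using assms(1) power_add[of "2::nat" 3 "m - 3"] by simp
  moreover have "m - 3 < 2 ^ (m - 3)" by (rule less_exp)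
  ultimately obtain q where q: "2 ^ m = 8 * q" "m - 3 < q" by blast
  \<comment> \<open>Writing \<open>n\<close> without subtraction makes its residue modulo 4 visible.\<close>
  define p where "p = q - 1"
  have n: "n = 8 * p + 5"
    using q assms(2) by (simp add: p_def)
  have "n mod 4 = 1"
    unfolding n by presburger
  moreover have "n \<ge> 2"
    unfolding n by simp
  moreover have "n + 3 = 2 ^ m" "2 ^ m - m - 3 + m = n"
    using q assms(1,2) by simp_all
  moreover from this have "2 ^ (2 ^ m - m - 3) * (n + 3) = 2 ^ n"
    by (metis power_add)
  ultimately interpret doubly_shortened_parameters n "2 ^ (2 ^ m - m - 3)" C1
    using assms(3) by unfold_locales
  have admissible_iff: "admissible B \<longleftrightarrow> twofold_perfect (n + 2) B
            \<and> {x @ [0, 0] | x. x \<in> C1} \<subseteq> set_mset B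
            \<and> (\<forall>w \<in> {x @ [0, 0] | x. x \<in> C1}. count B w = 2)
            \<and> (\<forall>x. x \<in># B \<and> (drop n x = [0, 1] \<or> drop n x = [1, 0])
                 \<longrightarrow> word_add x (replicate n 0 @ [1, 1]) \<in># B)" for B
  proof (cases "set_mset B \<subseteq> words (n + 2)")
    case True
    have "{x @ [0, 0] | x. x \<in> C1} \<subseteq> set_mset B" if "\<forall>x\<in>C1. count B (x @ [0, 0]) = 2"
      using that by (force simp flip: count_greater_zero_iff)
    then show ?thesis
      unfolding tail_symmetry_iff[OF True] admissible_def by blast
  qed (simp add: admissible_def twofold_perfect_def)
  show ?thesis using ex1_admissible unfolding admissible_iff .
qed

end
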